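(* Let $F(x,y,z)=(A(x,y),g(z+r(x)))$ on $\mathbb T^2\times\mathbb T$ with $A,g,r$ as in the context, and assume (A1)-(A3) as stated in the context. If additionally $\alpha^u_{min}$ is large enough, then for every $W^u$-curve segment $W$: (i) the set $\{p\in W:\liminf_{n\to\infty}\frac1n\log\|DF^n_p|_{E^c}\|>0\}$ is dense in $W$; (ii) the set $\{p\in W:\limsup_{n\to\infty}\frac1n\log\|DF^n_p|_{E^c}\|<0\}$ is dense in $W$.
   Context: $\mathbb T=\mathbb R/\mathbb Z$; $\partial_x,\partial_y,\partial_z$ are the unit vectors in the $x$-, $y$- and $z$-directions on $\mathbb T^2\times\mathbb T$. The map $A$: $A:\mathbb T^2\to\mathbb T^2$ is a $C^2$ Anosov diffeomorphism with $DA$-invariant splitting $T_{\mathrm p}\mathbb T^2=E^s_A(\mathrm p)\oplus E^u_A(\mathrm p)$ into one-dimensional subspaces, and there is $\lambda_A<1$ such that for all $\mathrm p\in\mathbb T^2$, $\|DA_{\mathrm p}w\|\le\lambda_A\|w\|$ for $w\in E^s_A(\mathrm p)$ and $\|D(A^{-1})_{\mathrm p}v\|\le\lambda_A\|v\|$ for $v\in E^u_A(\mathrm p)$. The map $g$: $g:\mathbb T\to\mathbb T$ is a $C^2$ invertible orientation-preserving map with $g'>0$ and with two fixed points, a repelling one $z_r$ and an attracting one $z_a$; for all $z\in\mathbb T\setminus\{z_a,z_r\}$, $g^nz\to z_a$ and $g^{-n}z\to z_r$ as $n\to\infty$; and $\lambda_g^{max}:=\max g'=g'(z_r)$, $\lambda_g^{min}:=\min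 g'=g'(z_a)$. The map $r$: $r:\mathbb T\to\mathbb T$ is an orientation-preserving diffeomorphism, so $r'>0$. Assumptions: (A1) $\lambda_A<\lambda_g^{min}<1<\lambda_g^{max}<(\lambda_A)^{-1}$. (A2) $r$ is $C^2$ with $c\le r'\le C$ for some $c,C>0$. (A3) (i) At every $\mathrm p\in\mathbb T^2$, $E^u_A(\mathrm p)$ and $E^s_A(\mathrm p)$ are not aligned with the $y$-axis. Let $\partial^u_A(\mathrm p)$ be the unit vector in $E^u_A(\mathrm p)$ with positive $x$-component and $\partial^s_A(\mathrm p)$ the unit vector in $E^s_A(\mathrm p)$ with negative $x$-component; by compactness there is $\beta>0$ such that $\partial^u_A(\mathrm p)\cdot\partial_x\ge\beta$ and $\partial^s_A(\mathrm p)\cdot\partial_x\le-\beta$ for all $\mathrm p\in\mathbb T^2$. (ii) Let $\alpha^u,\alpha^s$ be the functions on $\mathbb T^2$ with $DA_{\mathrm p}(\partial^u_A(\mathrm p))=\alpha^u(\mathrm p)\,\partial^u_A(A\mathrm p)$ and $DA_{\mathrm p}(\partial^s_A(\mathrm p))=\alpha^s(\mathrm p)\,\partial^s_A(A\mathrm p)$; assume (without loss of generality) $\alpha^u,\alpha^s>0$, and let $\alpha^u_{min}$ be the minimum of $\alpha^u$ over $\mathbb T^2$. Under (A1)-(A3) there is a $DF$-invariant continuous splitting $E^u\oplus E^c\oplus E^s$ of the tangent bundle of $\mathbb T^2\times\mathbb T$ into one-dimensional subbundles, where $E^c=\langle\partial_z\rangle$ with $\lambda_g^{min}\|v\|\le\|DFv\|\le\lambda_g^{max}\|v\|$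 for $v\in E^c$, $E^u\subset E^u_A\oplus\langle\partial_z\rangle$, $E^s\subset E^s_A\oplus\langle\partial_z\rangle$, and for some $c_0>0$ one has, for all $n\ge0$, $\|DF^nv\|\ge c_0(\lambda_A)^{-n}\|v\|$ for $v\in E^u$ and $\|DF^nv\|\le c_0^{-1}(\lambda_A)^n\|v\|$ for $v\in E^s$. The $W^u$-curves are the leaves of the $F$-invariant foliation of $\mathbb T^2\times\mathbb T$ tangent to $E^u$; a $W^u$-curve segment is a bounded piece of a $W^u$-curve. *)

theory Defs
  imports "HOL-Analysis.Analysis"
begin

section \<open>The circle and the tori\<close>

quotient_type circle = real / "\<lambda>x y :: real. x - y \<in> \<int>"
proof (rule equivpI)
  show "reflp (\<lambda>x y :: real. x - y \<in> \<int>)"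
    by (simp add: reflp_def)
  show "symp (\<lambda>x y :: real. x - y \<in> \<int>)"
    by (metis (mono_tags, lifting) Ints_minus minus_diff_eq sympI)
  show "transp (\<lambda>x y :: real. x - y \<in> \<int>)"
  proof (rule transpI)
    fix x y z :: real assume "x - y \<in> \<int>" "y - z \<in> \<int>"
    then have "(x - y) + (y - z) \<in> \<int>" by (rule Ints_add)
    then show "x - z \<in> \<int>" by simp
  qed
qed

lift_definition circ :: "real \<Rightarrow> circle" is "\<lambda>x. x" .

instantiation circle :: plus
begin
lift_definition plus_circle :: "circle \<Rightarrow> circle \<Rightarrow> circle" is "(+)"
  by (metis Ints_add add_diff_add)
instance ..
end

text \<open>The quotient topology of \<open>\<real>/\<int>\<close>; powers of the circle carry the product topology.\<close>

instantiation circle :: topological_space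
begin
definition open_circle :: "circle set \<Rightarrow> bool" where
  "open_circle U \<longleftrightarrow> open (circ -` U)"
instance
proof
  show "open (UNIV :: circle set)" by (simp add: open_circle_def)
next
  fix S T :: "circle set" assume "open S" "open T"
  then show "open (S \<inter> T)" by (auto simp: open_circle_def vimage_Int)
next
  fix K :: "circle set set" assume "\<forall>S\<in>K. open S"
  then show "open (\<Union>K)" by (auto simp: open_circle_def vimage_Union)
qed
end

type_synonym torus2 = "circle \<times> circle"
type_synonym torus3 = "torus2 \<times> circle"

text \<open>The tangent spaces are identified with \<open>\<real>\<^sup>2\<close> and \<open>\<real>\<^sup>3\<close>; the norm
  on a product of normed spaces is the Euclidean one.\<close>

type_synonym vec2 = "real \<times> real"
type_synonym vec3 = "vec2 \<times> real"

definition pi2 :: "vec2 \<Rightarrow> torus2" where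
  "pi2 = map_prod circ circ"

definition pi3 :: "vec3 \<Rightarrow> torus3" where
  "pi3 = map_prod pi2 circ"


section \<open>Differentiable maps of the tori\<close>

definition is_lift :: "('v::real_normed_vector \<Rightarrow> 'm) \<Rightarrow> ('v \<Rightarrow> 'v) \<Rightarrow> ('m \<Rightarrow> 'm) \<Rightarrow> bool" where
  "is_lift \<pi> ft f \<longleftrightarrow> continuous_on UNIV ft \<and> (\<forall>x. \<pi> (ft x) = f (\<pi> x))"

text \<open>For a covering map \<open>\<pi>\<close> of the circle or of a torus, two continuous lifts differ by a
  constant integer vector and lifts commute with integer translations up to such constants, so
  the derivative below depends neither on the lift nor on the base point over \<open>p\<close>.\<close>

definition tderiv :: "('v::real_normed_vector \<Rightarrow> 'm) \<Rightarrow> ('m \<Rightarrow> 'm) \<Rightarrow> 'm \<Rightarrow> 'v \<Rightarrow> 'v" where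
  "tderiv \<pi> f p = (THE L. \<exists>ft x. is_lift \<pi> ft f \<and> \<pi> x = p \<and> (ft has_derivative L) (at x))"

definition C1_map :: "('v::real_normed_vector \<Rightarrow> 'v) \<Rightarrow> bool" where
  "C1_map f \<longleftrightarrow> (\<exists>f' :: 'v \<Rightarrow> 'v \<Rightarrow>\<^sub>L 'v.
     (\<forall>x. (f has_derivative blinfun_apply (f' x)) (at x)) \<and> continuous_on UNIV f')"

definition C2_map :: "('v::real_normed_vector \<Rightarrow> 'v) \<Rightarrow> bool" where
  "C2_map f \<longleftrightarrow> (\<exists>(f' :: 'v \<Rightarrow> 'v \<Rightarrow>\<^sub>L 'v) (f'' :: 'v \<Rightarrow> 'v \<Rightarrow>\<^sub>L ('v \<Rightarrow>\<^sub>L 'v)).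
     (\<forall>x. (f has_derivative blinfun_apply (f' x)) (at x)) \<and>
     (\<forall>x. (f' has_derivative blinfun_apply (f'' x)) (at x)) \<and> continuous_on UNIV f'')"

definition torus_C1 :: "('v::real_normed_vector \<Rightarrow> 'm) \<Rightarrow> ('m \<Rightarrow> 'm) \<Rightarrow> bool" where
  "torus_C1 \<pi> f \<longleftrightarrow> (\<exists>ft. is_lift \<pi> ft f \<and> C1_map ft)"

definition torus_C2 :: "('v::real_normed_vector \<Rightarrow> 'm) \<Rightarrow> ('m \<Rightarrow> 'm) \<Rightarrow> bool" where
  "torus_C2 \<pi> f \<longleftrightarrow> (\<exists>ft. is_lift \<pi> ft f \<and> C2_map ft)"

definition C1_diffeo :: "('v::real_normed_vector \<Rightarrow> 'm) \<Rightarrow> ('m \<Rightarrow> 'm) \<Rightarrow> bool" where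
  "C1_diffeo \<pi> f \<longleftrightarrow> bij f \<and> torus_C1 \<pi> f \<and> torus_C1 \<pi> (inv f)"

definition C2_diffeo :: "('v::real_normed_vector \<Rightarrow> 'm) \<Rightarrow> ('m \<Rightarrow> 'm) \<Rightarrow> bool" where
  "C2_diffeo \<pi> f \<longleftrightarrow> bij f \<and> torus_C2 \<pi> f \<and> torus_C2 \<pi> (inv f)"

definition circle_deriv :: "(circle \<Rightarrow> circle) \<Rightarrow> circle \<Rightarrow> real" where
  "circle_deriv f z = tderiv circ f z 1"

definition orientation_preserving :: "(circle \<Rightarrow> circle) \<Rightarrow> bool" where
  "orientation_preserving f \<longleftrightarrow> (\<exists>ft. is_lift circ ft f \<and> strict_mono ft)"


section \<open>Line fields\<close>

definition line :: "'v::real_vector set \<Rightarrow> bool" where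
  "line E \<longleftrightarrow> subspace E \<and> dim E = 1"

definition direct_sum2 :: "'v::real_vector set \<Rightarrow> 'v set \<Rightarrow> bool" where
  "direct_sum2 E1 E2 \<longleftrightarrow>
     (\<forall>v. \<exists>!(a, b). a \<in> E1 \<and> b \<in> E2 \<and> v = a + b)"

definition direct_sum3 :: "'v::real_vector set \<Rightarrow> 'v set \<Rightarrow> 'v set \<Rightarrow> bool" where
  "direct_sum3 E1 E2 E3 \<longleftrightarrow>
     (\<forall>v. \<exists>!(a, b, c). a \<in> E1 \<and> b \<in> E2 \<and> c \<in> E3 \<and> v = a + b + c)"

definition invariant_field ::
    "('v::real_normed_vector \<Rightarrow> 'm) \<Rightarrow> ('m \<Rightarrow> 'm) \<Rightarrow> ('m \<Rightarrow> 'v set) \<Rightarrow> bool" where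
  "invariant_field \<pi> f E \<longleftrightarrow> (\<forall>p. tderiv \<pi> f p ` E p = E (f p))"

definition continuous_line_field ::
    "('m::topological_space \<Rightarrow> 'v::real_normed_vector set) \<Rightarrow> bool" where
  "continuous_line_field E \<longleftrightarrow> (\<forall>p. \<exists>U v. open U \<and> p \<in> U \<and> continuous_on U v \<and>
     (\<forall>q\<in>U. v q \<noteq> 0 \<and> E q = span {v q}))"

definition norm_on :: "('v::real_normed_vector \<Rightarrow> 'v) \<Rightarrow> 'v set \<Rightarrow> real" where
  "norm_on L E = (SUP v\<in>{v \<in> E. norm v = 1}. norm (L v))"


section \<open>The maps \<open>A\<close>, \<open>g\<close>, \<open>r\<close> and the standing assumptions\<close>

definition anosov ::
    "(torus2 \<Rightarrow> torus2) \<Rightarrow> (torus2 \<Rightarrow> vec2 set) \<Rightarrow> (torus2 \<Rightarrow> vec2 set) \<Rightarrow> real \<Rightarrow> bool" where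
  "anosov A EsA EuA lamA \<longleftrightarrow>
     C2_diffeo pi2 A \<and>
     (\<forall>p. line (EsA p) \<and> line (EuA p) \<and> direct_sum2 (EsA p) (EuA p)) \<and>
     invariant_field pi2 A EsA \<and> invariant_field pi2 A EuA \<and>
     lamA < 1 \<and>
     (\<forall>p. \<forall>w\<in>EsA p. norm (tderiv pi2 A p w) \<le> lamA * norm w) \<and>
     (\<forall>p. \<forall>v\<in>EuA p. norm (tderiv pi2 (inv A) p v) \<le> lamA * norm v)"

text \<open>The last clause says that \<open>\<lambda>\<^sub>g\<^sup>m\<^sup>a\<^sup>x\<close> and \<open>\<lambda>\<^sub>g\<^sup>m\<^sup>i\<^sup>n\<close>,
  the extreme values of the derivative, are attained at \<open>zr\<close> and \<open>za\<close>; below they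
  appear as \<open>circle_deriv g zr\<close> and \<open>circle_deriv g za\<close>.\<close>

definition north_south :: "(circle \<Rightarrow> circle) \<Rightarrow> circle \<Rightarrow> circle \<Rightarrow> bool" where
  "north_south g zr za \<longleftrightarrow>
     bij g \<and> torus_C2 circ g \<and> orientation_preserving g \<and> (\<forall>z. circle_deriv g z > 0) \<and>
     zr \<noteq> za \<and> {z. g z = z} = {zr, za} \<and>
     (\<forall>z. z \<notin> {za, zr} \<longrightarrow>
        (\<lambda>n. (g ^^ n) z) \<longlonglongrightarrow> za \<and> (\<lambda>n. (inv g ^^ n) z) \<longlonglongrightarrow> zr) \<and>
     (\<forall>z. circle_deriv g za \<le> circle_deriv g z \<and> circle_deriv g z \<le> circle_deriv g zr)"

definition assm_A1 :: "(circle \<Rightarrow> circle) \<Rightarrow> circle \<Rightarrow> circle \<Rightarrow> real \<Rightarrow> bool" where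
  "assm_A1 g zr za lamA \<longleftrightarrow>
     lamA < circle_deriv g za \<and> circle_deriv g za < 1 \<and>
     1 < circle_deriv g zr \<and> circle_deriv g zr < inverse lamA"

definition assm_A2 :: "(circle \<Rightarrow> circle) \<Rightarrow> bool" where
  "assm_A2 r \<longleftrightarrow> torus_C2 circ r \<and>
     (\<exists>c C. c > 0 \<and> C > 0 \<and> (\<forall>x. c \<le> circle_deriv r x \<and> circle_deriv r x \<le> C))"

definition unit_u :: "(torus2 \<Rightarrow> vec2 set) \<Rightarrow> torus2 \<Rightarrow> vec2" where
  "unit_u EuA p = (THE v. v \<in> EuA p \<and> norm v = 1 \<and> fst v > 0)"

definition unit_s :: "(torus2 \<Rightarrow> vec2 set) \<Rightarrow> torus2 \<Rightarrow> vec2" where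
  "unit_s EsA p = (THE v. v \<in> EsA p \<and> norm v = 1 \<and> fst v < 0)"

definition alpha_u :: "(torus2 \<Rightarrow> torus2) \<Rightarrow> (torus2 \<Rightarrow> vec2 set) \<Rightarrow> torus2 \<Rightarrow> real" where
  "alpha_u A EuA p = (THE a. tderiv pi2 A p (unit_u EuA p) = a *\<^sub>R unit_u EuA (A p))"

definition alpha_s :: "(torus2 \<Rightarrow> torus2) \<Rightarrow> (torus2 \<Rightarrow> vec2 set) \<Rightarrow> torus2 \<Rightarrow> real" where
  "alpha_s A EsA p = (THE a. tderiv pi2 A p (unit_s EsA p) = a *\<^sub>R unit_s EsA (A p))"

text \<open>The infimum is a minimum, since \<open>alpha_u\<close> is continuous on a compact space.\<close>

definition alpha_u_min :: "(torus2 \<Rightarrow> torus2) \<Rightarrow> (torus2 \<Rightarrow> vec2 set) \<Rightarrow> real" where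
  "alpha_u_min A EuA = (INF p. alpha_u A EuA p)"

definition assm_A3 ::
    "(torus2 \<Rightarrow> torus2) \<Rightarrow> (torus2 \<Rightarrow> vec2 set) \<Rightarrow> (torus2 \<Rightarrow> vec2 set) \<Rightarrow> real \<Rightarrow> bool" where
  "assm_A3 A EsA EuA \<beta> \<longleftrightarrow>
     (\<forall>p. EuA p \<noteq> span {(0, 1)} \<and> EsA p \<noteq> span {(0, 1)}) \<and>
     \<beta> > 0 \<and>
     (\<forall>p. unit_u EuA p \<bullet> (1, 0) \<ge> \<beta> \<and> unit_s EsA p \<bullet> (1, 0) \<le> - \<beta>) \<and>
     (\<forall>p. alpha_u A EuA p > 0 \<and> alpha_s A EsA p > 0)"


section \<open>The skew product, its invariant splitting and its unstable foliation\<close>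

fun skew :: "(torus2 \<Rightarrow> torus2) \<Rightarrow> (circle \<Rightarrow> circle) \<Rightarrow> (circle \<Rightarrow> circle) \<Rightarrow> torus3 \<Rightarrow> torus3" where
  "skew A g r ((x, y), z) = (A (x, y), g (z + r x))"

definition Ec :: "vec3 set" where
  "Ec = span {((0, 0), 1)}"

definition ph_splitting ::
    "(torus3 \<Rightarrow> torus3) \<Rightarrow> (torus2 \<Rightarrow> vec2 set) \<Rightarrow> (torus2 \<Rightarrow> vec2 set) \<Rightarrow> real \<Rightarrow> real \<Rightarrow> real \<Rightarrow>
     (torus3 \<Rightarrow> vec3 set) \<Rightarrow> (torus3 \<Rightarrow> vec3 set) \<Rightarrow> bool" where
  "ph_splitting F EsA EuA lamA gmin gmax Es Eu \<longleftrightarrow>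
     continuous_line_field Eu \<and> continuous_line_field Es \<and>
     (\<forall>p. direct_sum3 (Eu p) Ec (Es p)) \<and>
     invariant_field pi3 F Eu \<and> invariant_field pi3 F (\<lambda>_. Ec) \<and> invariant_field pi3 F Es \<and>
     (\<forall>p. \<forall>v\<in>Ec. gmin * norm v \<le> norm (tderiv pi3 F p v) \<and>
                norm (tderiv pi3 F p v) \<le> gmax * norm v) \<and>
     (\<forall>p. Eu p \<subseteq> EuA (fst p) \<times> UNIV \<and> Es p \<subseteq> EsA (fst p) \<times> UNIV) \<and>
     (\<exists>c0>0. \<forall>n p.
        (\<forall>v\<in>Eu p. norm (tderiv pi3 (F ^^ n) p v) \<ge> c0 * inverse lamA ^ n * norm v) \<and>
        (\<forall>v\<in>Es p. norm (tderiv pi3 (F ^^ n) p v) \<le> inverse c0 * lamA ^ n * norm v))"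

text \<open>Arclength parametrizations, given by their lifts to \<open>\<real>\<^sup>3\<close>, of complete
  \<open>C\<^sup>1\<close> curves tangent to \<open>E\<close>.\<close>

definition unit_speed_curve :: "(torus3 \<Rightarrow> vec3 set) \<Rightarrow> (real \<Rightarrow> vec3) \<Rightarrow> bool" where
  "unit_speed_curve E \<gamma> \<longleftrightarrow> (\<exists>\<gamma>'. continuous_on UNIV \<gamma>' \<and>
     (\<forall>t. (\<gamma> has_vector_derivative \<gamma>' t) (at t) \<and> norm (\<gamma>' t) = 1 \<and> \<gamma>' t \<in> E (pi3 (\<gamma> t))))"

text \<open>A partition into \<open>C\<^sup>1\<close> curves tangent to \<open>E\<close> with local product charts:
  the horizontal plaques of each chart lie in single leaves.\<close>

definition foliation_tangent_to :: "(torus3 \<Rightarrow> vec3 set) \<Rightarrow> torus3 set set \<Rightarrow> bool" where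
  "foliation_tangent_to E \<F> \<longleftrightarrow>
     \<Union>\<F> = UNIV \<and> disjoint \<F> \<and>
     (\<forall>L\<in>\<F>. \<exists>\<gamma>. unit_speed_curve E \<gamma> \<and> L = range (pi3 \<circ> \<gamma>)) \<and>
     (\<forall>p. \<exists>U \<phi> \<psi>. open U \<and> p \<in> U \<and>
        homeomorphism ({-1<..<1} \<times> ball (0 :: real \<times> real) 1) U \<phi> \<psi> \<and>
        (\<forall>y\<in>ball 0 1. \<exists>L\<in>\<F>. \<phi> ` ({-1<..<1 :: real} \<times> {y}) \<subseteq> L))"

definition invariant_foliation :: "(torus3 \<Rightarrow> torus3) \<Rightarrow> torus3 set set \<Rightarrow> bool" where
  "invariant_foliation F \<F> \<longleftrightarrow> (\<forall>L\<in>\<F>. F ` L \<in> \<F>)"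

definition curve_segment :: "(torus3 \<Rightarrow> vec3 set) \<Rightarrow> torus3 set set \<Rightarrow> torus3 set \<Rightarrow> bool" where
  "curve_segment E \<F> W \<longleftrightarrow> (\<exists>L\<in>\<F>. \<exists>\<gamma> I. unit_speed_curve E \<gamma> \<and> L = range (pi3 \<circ> \<gamma>) \<and>
     is_interval I \<and> bounded I \<and> interior I \<noteq> {} \<and> W = (pi3 \<circ> \<gamma>) ` I)"

definition dense_in :: "'a::topological_space set \<Rightarrow> 'a set \<Rightarrow> bool" where
  "dense_in S W \<longleftrightarrow> S \<subseteq> W \<and> W \<subseteq> closure S"

definition center_growth :: "(torus3 \<Rightarrow> torus3) \<Rightarrow> torus3 \<Rightarrow> nat \<Rightarrow> ereal" where
  "center_growth F p n = ereal (1 / real n * ln (norm_on (tderiv pi3 (F ^^ n) p) Ec))"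

end

theory Submission
  imports Defs
begin

text \<open>For a point \<open>(x, y, z)\<close> of the lifted curve let \<open>w\<^sub>n = z\<^sub>n + r(x\<^sub>n)\<close> be the phase of its
  \<open>n\<close>-th iterate, so that the center derivative of \<open>F\<^sup>n\<close> is the product of the \<open>g'(w\<^sub>k)\<close> for
  \<open>k < n\<close>. When \<open>\<alpha>\<^sup>u\<^sub>m\<^sub>i\<^sub>n\<close> is large the iterated curve becomes almost horizontal, and as \<open>r'\<close> and
  the \<open>x\<close>-components of \<open>E\<^sup>u\<^sub>A\<close> are bounded away from zero, the speed of \<open>w\<^sub>n\<^sub>+\<^sub>1\<close> along the curve
  exceeds that of \<open>w\<^sub>n\<close> by a large factor, pointwise. Hence every piece of the curve contains a point
  whose phases eventually all stay in a prescribed arc, chosen around \<open>z\<^sub>r\<close>, where \<open>g' > 1\<close>, or around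
  \<open>z\<^sub>a\<close>, where \<open>g' < 1\<close>.\<close>

section \<open>Derivatives through lifts\<close>

lemma circ_eq_iff: "circ x = circ y \<longleftrightarrow> x - y \<in> \<int>"
  by transfer simp

lemma circ_surj: "\<exists>x. circ x = z"
  by transfer (metis Ints_0 diff_self)

lemma circ_add: "circ x + circ y = circ (x + y)"
  by transfer simp

lemma pi2_eq_iff: "pi2 p = pi2 q \<longleftrightarrow> p - q \<in> \<int> \<times> \<int>"
  by (cases p; cases q) (simp add: pi2_def circ_eq_iff)

lemma pi3_eq_iff: "pi3 p = pi3 q \<longleftrightarrow> p - q \<in> (\<int> \<times> \<int>) \<times> \<int>"
  by (cases p; cases q) (simp add: pi3_def pi2_eq_iff circ_eq_iff)

lemma continuous_on_circ: "continuous_on S circ"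
  by (rule continuous_on_subset[of UNIV])
     (auto simp: continuous_on_open_vimage open_circle_def)

lemma continuous_on_pi3: "continuous_on S pi3"
proof -
  have "continuous_on S (\<lambda>q :: vec3. ((circ (fst (fst q)), circ (snd (fst q))), circ (snd q)))"
    by (intro continuous_intros continuous_on_compose2[OF continuous_on_circ[of UNIV]]) auto
  also have "(\<lambda>q :: vec3. ((circ (fst (fst q)), circ (snd (fst q))), circ (snd q))) = pi3"
    by (auto simp: pi3_def pi2_def fun_eq_iff)
  finally show ?thesis .
qed

lemma continuous_Ints_valued_constant:
  fixes f :: "'a::real_normed_vector \<Rightarrow> real"
  assumes "continuous_on UNIV f" "\<And>x. f x \<in> \<int>"
  shows "f constant_on UNIV"
proof (rule continuous_discrete_range_constant)
  fix x :: 'a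
  show "\<exists>e>0. \<forall>y. y \<in> UNIV \<and> f y \<noteq> f x \<longrightarrow> e \<le> norm (f y - f x)"
    using assms(2) by (intro exI[of _ 1]) (auto intro!: Ints_nonzero_abs_ge1)
qed (use assms in auto)

text \<open>Treats the projections of the line, the plane and space onto their tori at once.
  \<open>valued_constant\<close> is the consequence of the discreteness of \<open>\<Lambda>\<close>
  on which the comparison of two lifts rests.\<close>

locale lattice_projection =
  fixes \<pi> :: "'v::real_normed_vector \<Rightarrow> 'm" and \<Lambda> :: "'v set"
  assumes proj_eq_iff: "\<pi> x = \<pi> y \<longleftrightarrow> x - y \<in> \<Lambda>"
    and valued_constant: "continuous_on UNIV d \<Longrightarrow> (\<And>x. d x \<in> \<Lambda>) \<Longrightarrow> d constant_on (UNIV :: 'v set)"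
begin

text \<open>Translating the argument of \<open>f2\<close> by \<open>x2 - x1\<close> yields another
  lift of \<open>f\<close>. It differs from \<open>f1\<close> by a continuous
  \<open>\<Lambda>\<close>-valued function, that is, by a constant, which differentiation does not
  see.\<close>

lemma lift_derivative_unique:
  assumes "is_lift \<pi> f1 f" "is_lift \<pi> f2 f" "\<pi> x1 = \<pi> x2"
    and "(f1 has_derivative L1) (at x1)" "(f2 has_derivative L2) (at x2)"
  shows "L1 = L2"
proof -
  define d where "d y = f2 (y + (x2 - x1)) - f1 y" for y
  have per: "\<pi> (y + (x2 - x1)) = \<pi> y" for y
    using assms(3) by (simp add: proj_eq_iff[of "y + (x2 - x1)"] proj_eq_iff[of x2, symmetric])
  have "continuous_on UNIV d"
    unfolding d_def using assms(1,2)
    by (auto simp: is_lift_def intro!: continuous_intros continuous_on_compose2[of UNIV f2])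
  moreover have "d y \<in> \<Lambda>" for y
    using assms(1,2) per[of y] unfolding d_def is_lift_def by (metis proj_eq_iff)
  ultimately obtain e where e: "\<And>y. d y = e"
    using valued_constant[of d] unfolding constant_on_def by auto
  have shift: "((\<lambda>y. y + (x2 - x1)) has_derivative (\<lambda>h. h)) (at x1)"
    by (auto intro!: derivative_eq_intros)
  have "((\<lambda>y. f2 (y + (x2 - x1))) has_derivative L2) (at x1)"
    using has_derivative_compose[OF shift, of f2 L2] assms(5) by simp
  moreover have "(\<lambda>y. f2 (y + (x2 - x1))) = (\<lambda>y. f1 y + e)"
    using e by (auto simp: d_def fun_eq_iff diff_eq_eq add.commute)
  ultimately have "((\<lambda>y. f1 y + e) has_derivative L2) (at x1)"
    by simp
  moreover have "((\<lambda>y. f1 y + e) has_derivative L1) (at x1)"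
    using assms(4) by (auto intro!: derivative_eq_intros)
  ultimately show ?thesis
    by (rule has_derivative_unique[symmetric])
qed

lemma tderiv_eq:
  assumes "is_lift \<pi> ft f" "(ft has_derivative L) (at x)"
  shows "tderiv \<pi> f (\<pi> x) = L"
  unfolding tderiv_def
proof (rule the_equality)
  show "\<exists>ft y. is_lift \<pi> ft f \<and> \<pi> y = \<pi> x \<and> (ft has_derivative L) (at y)"
    using assms by blast
qed (use assms lift_derivative_unique in metis)

end

interpretation circ: lattice_projection circ "\<int>"
  by unfold_locales (auto simp: circ_eq_iff intro: continuous_Ints_valued_constant)

lemma constant_on_fst_snd:
  assumes "(\<lambda>x. fst (f x)) constant_on S" "(\<lambda>x. snd (f x)) constant_on S"
  shows "f constant_on S"
  using assms unfolding constant_on_def by (metis prod.collapse)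

interpretation pi2: lattice_projection pi2 "\<int> \<times> \<int>"
  by unfold_locales
     (auto simp: pi2_eq_iff mem_Times_iff
       intro!: constant_on_fst_snd continuous_Ints_valued_constant continuous_intros)

interpretation pi3: lattice_projection pi3 "(\<int> \<times> \<int>) \<times> \<int>"
  by unfold_locales
     (auto simp: pi3_eq_iff mem_Times_iff
       intro!: constant_on_fst_snd continuous_Ints_valued_constant continuous_intros)

section \<open>Iterates and their derivatives\<close>

lemma is_lift_funpow:
  assumes "is_lift \<pi> ft f"
  shows "is_lift \<pi> (ft ^^ n) (f ^^ n)"
proof (induction n)
  case 0
  then show ?case by (simp add: is_lift_def)
next
  case (Suc n)
  then show ?case
    using assms by (auto simp: is_lift_def comp_def intro: continuous_on_compose2)
qed

text \<open>The derivative cocycle of the chain rule, written as a recursion so that estimates along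
  an orbit go by induction on \<open>n\<close>.\<close>

primrec iterate_deriv ::
    "('v \<Rightarrow> 'v \<Rightarrow> 'v) \<Rightarrow> ('v \<Rightarrow> 'v) \<Rightarrow> nat \<Rightarrow> 'v \<Rightarrow> 'v \<Rightarrow> 'v" where
  "iterate_deriv D f 0 x = (\<lambda>v. v)"
| "iterate_deriv D f (Suc n) x = (\<lambda>v. D ((f ^^ n) x) (iterate_deriv D f n x v))"

lemma has_derivative_funpow:
  assumes "\<And>x. (f has_derivative D x) (at x)"
  shows "((f ^^ n) has_derivative iterate_deriv D f n x) (at x)"
proof (induction n)
  case 0
  then show ?case by (simp add: id_def)
next
  case (Suc n)
  from has_derivative_compose[OF Suc assms] show ?case by (simp add: comp_def)
qed

text \<open>The unit vectors of \<open>Ec\<close> are the vertical unit vector and its negative, so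
  the supremum is taken over the single value \<open>\<mu>\<close>.\<close>

lemma norm_on_Ec:
  assumes "\<And>s. L (s *\<^sub>R ((0, 0), 1)) = (s * \<mu>) *\<^sub>R ((0, 0), 1)" "0 \<le> \<mu>"
  shows "norm_on L Ec = \<mu>"
proof -
  have "norm (L v) = \<mu>" if "v \<in> Ec" "norm v = 1" for v
  proof -
    from that(1) obtain s where "v = s *\<^sub>R ((0, 0), 1)"
      by (auto simp: Ec_def span_singleton)
    with that(2) assms show ?thesis
      by (simp add: norm_Pair abs_mult)
  qed
  moreover have "((0, 0), 1) \<in> {v \<in> Ec. norm v = 1}"
    by (auto simp: Ec_def span_base norm_Pair)
  ultimately have "(\<lambda>v. norm (L v)) ` {v \<in> Ec. norm v = 1} = {\<mu>}"
    by force
  then show ?thesis by (simp add: norm_on_def)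
qed


section \<open>Expanding phases\<close>

text \<open>By Cauchy's mean value theorem the ratio of the two increments is \<open>h' / f'\<close>
  at an intermediate point, so a pointwise expansion rate passes to increments without a distortion
  estimate.\<close>

lemma abs_increment_expands:
  fixes f h :: "real \<Rightarrow> real"
  assumes "a < b"
    and "\<And>t. t \<in> {a..b} \<Longrightarrow> (f has_real_derivative f' t) (at t)"
    and "\<And>t. t \<in> {a..b} \<Longrightarrow> (h has_real_derivative h' t) (at t)"
    and "\<And>t. t \<in> {a..b} \<Longrightarrow> f' t \<noteq> 0"
    and "\<And>t. t \<in> {a..b} \<Longrightarrow> M * \<bar>f' t\<bar> \<le> \<bar>h' t\<bar>"
  shows "M * \<bar>f b - f a\<bar> \<le> \<bar>h b - h a\<bar>"
proof -
  obtain k l \<xi> where k: "DERIV h \<xi> :> k" "DERIV f \<xi> :> l" and \<xi>: "a < \<xi>" "\<xi> < b"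
    and kl: "(f b - f a) * k = (h b - h a) * l"
  proof -
    have "\<exists>k l c. DERIV h c :> k \<and> DERIV f c :> l \<and> a < c \<and> c < b \<and> (f b - f a) * k = (h b - h a) * l"
      using assms(1,2,3)
      by (intro GMVT) (auto intro: DERIV_isCont simp: real_differentiable_def, force+)
    with that show thesis by auto
  qed
  have \<xi>_mem: "\<xi> \<in> {a..b}" using \<xi> by simp
  have k_eq: "k = h' \<xi>" "l = f' \<xi>"
    using DERIV_unique[OF k(1) assms(3)[OF \<xi>_mem]] DERIV_unique[OF k(2) assms(2)[OF \<xi>_mem]] by auto
  have "(M * \<bar>f b - f a\<bar>) * \<bar>f' \<xi>\<bar> \<le> \<bar>f b - f a\<bar> * \<bar>h' \<xi>\<bar>"
    using mult_left_mono[OF assms(5)[OF \<xi>_mem], of "\<bar>f b - f a\<bar>"] by (simp add: mult_ac)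
  also have "\<dots> = \<bar>h b - h a\<bar> * \<bar>f' \<xi>\<bar>"
    using kl k_eq by (metis abs_mult)
  finally show ?thesis
    using assms(4)[OF \<xi>_mem] by simp
qed

text \<open>A range of length 2 contains a whole integer translate of an arc of length
  \<open>2 * d\<close>, because \<open>1 + 2 * d\<close> is at most 2. Injectivity makes
  \<open>f\<close> monotone, so the preimage of the translate is an interval.\<close>

lemma subinterval_onto_translate:
  fixes f :: "real \<Rightarrow> real"
  assumes "a < b" "continuous_on {a..b} f" "inj_on f {a..b}" and "2 \<le> \<bar>f b - f a\<bar>"
    and "0 < d" "d \<le> 1/2"
  shows "\<exists>a' b' (m::int). a \<le> a' \<and> a' < b' \<and> b' \<le> b \<and> \<bar>f b' - f a'\<bar> = 2 * d \<and>
           (\<forall>t\<in>{a'..b'}. \<bar>f t - c - m\<bar> \<le> d)"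
proof -
  \<comment> \<open>The least integer for which the lower end \<open>l\<close> of the translate is
    not below the range; the upper end \<open>u\<close> is then below
    \<open>min (f a) (f b) + 1 + 2 * d\<close>.\<close>
  define m where "m = \<lceil>min (f a) (f b) - c + d\<rceil>"
  define l u where "l = c + m - d" and "u = c + m + d"
  have m: "min (f a) (f b) - c + d \<le> m" "m < min (f a) (f b) - c + d + 1"
    unfolding m_def by linarith+
  have rng: "min (f a) (f b) \<le> l" "l < u" "u \<le> max (f a) (f b)"
    using m assms(4-6) by (auto simp: l_def u_def)
  have ex: "\<exists>t\<in>{a..b}. f t = y" if "min (f a) (f b) \<le> y" "y \<le> max (f a) (f b)" for y
    using that assms(1,2) IVT'[of f a y b] IVT2'[of f b y a] by (fastforce simp: min_def max_def split: if_splits)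
  obtain s where s: "s \<in> {a..b}" "f s = l" using ex[of l] rng by auto
  obtain v where v: "v \<in> {a..b}" "f v = u" using ex[of u] rng by auto
  \<comment> \<open>The order of \<open>s\<close> and \<open>v\<close> is reversed when
    \<open>f\<close> decreases.\<close>
  define a' b' where "a' = min s v" and "b' = max s v"
  have "s \<noteq> v" using s v rng by auto
  then have ab: "a \<le> a'" "a' < b'" "b' \<le> b" using s v by (auto simp: a'_def b'_def)
  have ends: "{f a', f b'} = {l, u}"
    using s v by (auto simp: a'_def b'_def min_def max_def)
  have "f t \<in> {l..u}" if "t \<in> {a'..b'}" for t
  proof (cases "t = a' \<or> t = b'")
    case True
    then have "f t \<in> {l, u}" using ends by blast
    then show ?thesis using rng by auto
  next
    case False
    have "continuous_on {a'..b'} f" "inj_on f {a'..b'}"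
      using ab assms(2,3) by (auto intro: continuous_on_subset inj_on_subset)
    then have "(f a' < f t \<and> f t < f b') \<or> (f b' < f t \<and> f t < f a')"
      using False that by (intro continuous_inj_imp_mono) auto
    then show ?thesis using ends rng by (auto simp: doubleton_eq_iff)
  qed
  then have "\<forall>t\<in>{a'..b'}. \<bar>f t - c - m\<bar> \<le> d"
    by (force simp: l_def u_def abs_le_iff)
  moreover have "\<bar>f b' - f a'\<bar> = 2 * d"
    using ends rng(2) assms(5) by (auto simp: doubleton_eq_iff l_def u_def)
  ultimately show ?thesis using ab by blast
qed

text \<open>The increments of the phases over a fixed interval grow geometrically, so some phase wraps
  twice around the circle. Each later phase wraps twice around over an interval on which its
  predecessor sweeps the target arc once, so the target arcs can be followed through a
  nested sequence of intervals.\<close>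

lemma expanding_phases_track_arc:
  fixes w :: "nat \<Rightarrow> real \<Rightarrow> real"
  assumes "a < b"
    and der: "\<And>n t. t \<in> {a..b} \<Longrightarrow> (w n has_real_derivative w' n t) (at t)"
    and nz: "\<And>n t. t \<in> {a..b} \<Longrightarrow> w' n t \<noteq> 0"
    and expand: "\<And>n t. t \<in> {a..b} \<Longrightarrow> M * \<bar>w' n t\<bar> \<le> \<bar>w' (Suc n) t\<bar>"
    and "2 \<le> M" "0 < d" "d \<le> 1/2" "1 \<le> M * d"
  shows "\<exists>t\<in>{a..b}. \<exists>N. \<forall>n\<ge>N. \<exists>m::int. \<bar>w n t - c - m\<bar> \<le> d"
proof -
  have cont: "continuous_on {a..b} (w n)" for n
    by (rule continuous_at_imp_continuous_on) (meson DERIV_isCont der)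
  have grow: "M * \<bar>w n y - w n x\<bar> \<le> \<bar>w (Suc n) y - w (Suc n) x\<bar>"
    if "a \<le> x" "x < y" "y \<le> b" for n x y
    using that by (intro abs_increment_expands[of x y _ "w' n" _ "w' (Suc n)"] der nz expand) auto
  have neq: "w n x \<noteq> w n y" if "a \<le> x" "x < y" "y \<le> b" for n x y
  proof
    assume "w n x = w n y"
    moreover have "\<exists>z>x. z < y \<and> w n y - w n x = (y - x) * w' n z"
      using that by (intro MVT2 der) auto
    ultimately show False using that nz[of _ n] by force
  qed
  have inj: "inj_on (w n) {a..b}" for n
    using neq by (auto simp: inj_on_def) (metis linorder_neqE_linordered_idom)
  have step: "\<exists>x' y'. (x \<le> x' \<and> x' < y' \<and> y' \<le> y) \<and> \<bar>w n y' - w n x'\<bar> = 2 * d \<and>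
         (\<forall>t\<in>{x'..y'}. \<exists>m::int. \<bar>w n t - c - m\<bar> \<le> d)"
    if "a \<le> x" "x < y" "y \<le> b" "2 \<le> \<bar>w n y - w n x\<bar>" for n x y
  proof -
    have "continuous_on {x..y} (w n)" "inj_on (w n) {x..y}"
      using that cont[of n] inj[of n] by (auto intro: continuous_on_subset inj_on_subset)
    from subinterval_onto_translate[OF that(2) this that(4) assms(6,7), of c]
    show ?thesis by blast
  qed
  have pow: "2 ^ n * \<bar>w 0 b - w 0 a\<bar> \<le> \<bar>w n b - w n a\<bar>" for n
  proof (induction n)
    case (Suc n)
    have "2 ^ Suc n * \<bar>w 0 b - w 0 a\<bar> \<le> 2 * \<bar>w n b - w n a\<bar>" using Suc by simp
    also have "\<dots> \<le> M * \<bar>w n b - w n a\<bar>" using assms(5) by (intro mult_right_mono) auto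
    also have "\<dots> \<le> \<bar>w (Suc n) b - w (Suc n) a\<bar>" using grow[of a b n] assms(1) by simp
    finally show ?case .
  qed simp
  have pos: "0 < \<bar>w 0 b - w 0 a\<bar>" using neq[of a b 0] assms(1) by auto
  obtain N where "2 / \<bar>w 0 b - w 0 a\<bar> < 2 ^ N"
    using real_arch_pow[of 2 "2 / \<bar>w 0 b - w 0 a\<bar>"] by auto
  then have N: "2 \<le> \<bar>w N b - w N a\<bar>"
    using pow[of N] pos by (simp add: divide_simps)
  \<comment> \<open>The pair \<open>I\<close> encodes an interval by its end points. On it the phase
    of index \<open>N + n\<close> has total increment \<open>2 * d\<close> and stays in the target
    arc modulo 1.\<close>
  define P where "P n I \<longleftrightarrow> (a \<le> fst I \<and> fst I < snd I \<and> snd I \<le> b) \<and>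
      \<bar>w (N + n) (snd I) - w (N + n) (fst I)\<bar> = 2 * d \<and>
      (\<forall>t\<in>{fst I..snd I}. \<exists>m::int. \<bar>w (N + n) t - c - m\<bar> \<le> d)" for n and I :: "real \<times> real"
  have "\<exists>X. \<forall>n. P n (X n) \<and> (fst (X n) \<le> fst (X (Suc n)) \<and> snd (X (Suc n)) \<le> snd (X n))"
  proof (rule dependent_nat_choice)
    obtain x' y' where "a \<le> x'" "x' < y'" "y' \<le> b" "\<bar>w N y' - w N x'\<bar> = 2 * d"
        "\<forall>t\<in>{x'..y'}. \<exists>m::int. \<bar>w N t - c - m\<bar> \<le> d"
      using step[of a b N] assms(1) N by blast
    then have "P 0 (x', y')" unfolding P_def by simp
    then show "\<exists>I. P 0 I" ..
  next
    fix I n assume I: "P n I"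
    then have "M * (2 * d) \<le> \<bar>w (N + Suc n) (snd I) - w (N + Suc n) (fst I)\<bar>"
      using grow[of "fst I" "snd I" "N + n"] unfolding P_def by auto
    \<comment> \<open>The current increment \<open>2 * d\<close> becomes at least
      \<open>M * (2 * d)\<close> for the next phase, hence at least 2, as \<open>step\<close>
      requires.\<close>
    then have "2 \<le> \<bar>w (N + Suc n) (snd I) - w (N + Suc n) (fst I)\<bar>"
      using assms(8) by (simp add: algebra_simps)
    then obtain x' y' where "fst I \<le> x'" "x' < y'" "y' \<le> snd I"
        "\<bar>w (N + Suc n) y' - w (N + Suc n) x'\<bar> = 2 * d"
        "\<forall>t\<in>{x'..y'}. \<exists>m::int. \<bar>w (N + Suc n) t - c - m\<bar> \<le> d"
      using step[of "fst I" "snd I" "N + Suc n"] I unfolding P_def by blast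
    then have "P (Suc n) (x', y') \<and> fst I \<le> fst (x', y') \<and> snd (x', y') \<le> snd I"
      using I unfolding P_def by auto
    then show "\<exists>J. P (Suc n) J \<and> fst I \<le> fst J \<and> snd J \<le> snd I" by blast
  qed
  then obtain X where X: "\<And>n. P n (X n)"
    and nest: "\<And>n. fst (X n) \<le> fst (X (Suc n)) \<and> snd (X (Suc n)) \<le> snd (X n)" by blast
  \<comment> \<open>A common point of these nested compact intervals has all phases from
    \<open>N\<close> on in the arc.\<close>
  have "(\<Inter>n. {fst (X n)..snd (X n)}) \<noteq> {}"
  proof (rule compact_nest)
    show "compact {fst (X n)..snd (X n)}" "{fst (X n)..snd (X n)} \<noteq> {}" for n
      using X[of n] by (auto simp: P_def)
    have "decseq (\<lambda>n. {fst (X n)..snd (X n)})"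
      using nest by (intro decseq_SucI) auto
    then show "{fst (X n)..snd (X n)} \<subseteq> {fst (X m)..snd (X m)}" if "m \<le> n" for m n
      using that by (rule decseqD)
  qed
  then obtain t where t: "\<And>n. t \<in> {fst (X n)..snd (X n)}" by blast
  have "\<exists>m::int. \<bar>w n t - c - m\<bar> \<le> d" if "N \<le> n" for n
    using X[of "n - N"] t[of "n - N"] that unfolding P_def by auto
  moreover have "t \<in> {a..b}"
    using X[of 0] t[of 0] unfolding P_def by auto
  ultimately show ?thesis by blast
qed


section \<open>Lifted skew products\<close>

text \<open>Differentiable lifts are fixed once, so that orbits and derivatives are computed in
  Euclidean space. Linearity of \<open>A'\<close> is contained in \<open>deriv_A\<close>.\<close>

locale skew_product_lift =
  fixes A :: "torus2 \<Rightarrow> torus2" and g r :: "circle \<Rightarrow> circle"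
    and At :: "vec2 \<Rightarrow> vec2" and A' :: "vec2 \<Rightarrow> vec2 \<Rightarrow> vec2"
    and gt g' rt r' :: "real \<Rightarrow> real"
  assumes lift_A: "is_lift pi2 At A" and lift_g: "is_lift circ gt g" and lift_r: "is_lift circ rt r"
    and deriv_A: "(At has_derivative A' p) (at p)"
    and deriv_g: "(gt has_real_derivative g' x) (at x)"
    and deriv_r: "(rt has_real_derivative r' x) (at x)"
    and g'_pos: "0 < g' x"
begin

text \<open>The point at which the lift of \<open>g\<close> is evaluated. It determines the center
  derivative, and through \<open>rt\<close> it responds to horizontal motion, which
  \<open>snd q\<close> by itself does not.\<close>

definition phase :: "vec3 \<Rightarrow> real" where
  "phase q = snd q + rt (fst (fst q))"

definition dphase :: "vec3 \<Rightarrow> vec3 \<Rightarrow> real" where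
  "dphase q v = snd v + r' (fst (fst q)) * fst (fst v)"

definition Ft :: "vec3 \<Rightarrow> vec3" where
  "Ft q = (At (fst q), gt (phase q))"

definition DF :: "vec3 \<Rightarrow> vec3 \<Rightarrow> vec3" where
  "DF q v = (A' (fst q) (fst v), g' (phase q) * dphase q v)"

abbreviation "DFn \<equiv> iterate_deriv DF Ft"

lemma lift_skew: "is_lift pi3 Ft (skew A g r)"
proof -
  have "continuous_on UNIV Ft"
    using lift_A lift_g lift_r unfolding Ft_def phase_def is_lift_def
    by (auto intro!: continuous_intros continuous_on_compose2[of UNIV At]
          continuous_on_compose2[of UNIV gt] continuous_on_compose2[of UNIV rt])
  moreover have "pi3 (Ft q) = skew A g r (pi3 q)" for q
    using lift_A lift_g lift_r unfolding is_lift_def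
    by (cases q; cases "fst q") (simp add: Ft_def phase_def pi3_def pi2_def circ_add[symmetric])
  ultimately show ?thesis by (simp add: is_lift_def)
qed

lemma has_derivative_phase: "(phase has_derivative dphase q) (at q)"
  unfolding phase_def[abs_def] dphase_def[abs_def]
  by (auto intro!: derivative_eq_intros
        has_derivative_compose[OF _ deriv_r[unfolded has_field_derivative_def]])

lemma has_derivative_Ft: "(Ft has_derivative DF q) (at q)"
  unfolding Ft_def[abs_def] DF_def[abs_def]
  by (auto intro!: derivative_eq_intros has_derivative_compose[OF _ deriv_A]
        has_derivative_compose[OF has_derivative_phase deriv_g[unfolded has_field_derivative_def]])

lemma tderiv_skew_funpow: "tderiv pi3 (skew A g r ^^ n) (pi3 q) = DFn n q"
  by (rule pi3.tderiv_eq[OF is_lift_funpow[OF lift_skew] has_derivative_funpow[OF has_derivative_Ft]])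

lemma linear_A': "linear (A' p)"
  using deriv_A has_derivative_linear by blast

text \<open>A vertical vector has no horizontal part for \<open>A'\<close> or \<open>r'\<close> to
  act on, so each step only multiplies it by \<open>g'\<close> at the current phase.\<close>

lemma DFn_vertical:
  "DFn n q (s *\<^sub>R ((0, 0), 1)) = (s * (\<Prod>k<n. g' (phase ((Ft ^^ k) q)))) *\<^sub>R ((0, 0), 1)"
proof (induction n)
  case (Suc n)
  then show ?case
    using linear_0[OF linear_A'] by (simp add: DF_def dphase_def zero_prod_def)
qed simp

text \<open>Center growth is thus a Birkhoff average of \<open>ln g'\<close> along the phases. At
  \<open>n = 0\<close> both sides are 0 by the convention for division by 0.\<close>

lemma center_growth_eq:
  "center_growth (skew A g r) (pi3 q) n = ereal ((\<Sum>k<n. ln (g' (phase ((Ft ^^ k) q)))) / n)"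
proof -
  have "norm_on (DFn n q) Ec = (\<Prod>k<n. g' (phase ((Ft ^^ k) q)))"
    by (rule norm_on_Ec[OF DFn_vertical]) (simp add: g'_pos less_imp_le prod_nonneg)
  then show ?thesis
    using g'_pos by (simp add: center_growth_def tderiv_skew_funpow ln_prod less_imp_neq[symmetric])
qed

end

section \<open>Growth of the phase speed along iterated curves\<close>

context skew_product_lift
begin

text \<open>The vertical slope of the transported tangent vector satisfies an affine recursion with
  factor at most \<open>G / K\<close>. So it eventually stays below half of the horizontal contribution
  \<open>c * \<beta>\<close> to the phase speed, whatever the initial slope is. From then on the phase speed is
  comparable to the horizontal speed, which grows by the factor \<open>K\<close>.\<close>

lemma phases_track_arc:
  fixes E :: "vec2 \<Rightarrow> vec2 set"
  assumes "a < b"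
    and \<gamma>: "\<And>t. t \<in> {a..b} \<Longrightarrow> (\<gamma> has_vector_derivative \<gamma>' t) (at t)"
    and cont: "continuous_on {a..b} \<gamma>'"
    and tangent: "\<And>t. t \<in> {a..b} \<Longrightarrow> fst (\<gamma>' t) \<in> E (fst (\<gamma> t)) \<and> fst (\<gamma>' t) \<noteq> 0"
    and inv: "\<And>p v. v \<in> E p \<Longrightarrow> A' p v \<in> E (At p)"
    and grow: "\<And>p v. v \<in> E p \<Longrightarrow> K * norm v \<le> norm (A' p v)"
    and cone: "\<And>p v. v \<in> E p \<Longrightarrow> \<beta> * norm v \<le> \<bar>fst v\<bar>"
    and r': "\<And>x. c \<le> r' x" "\<And>x. r' x \<le> C" and g': "\<And>x. g' x \<le> G"
    and pos: "0 < c" "0 < \<beta>"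
    and K: "2 * G \<le> K" "8 * G * C \<le> K * (c * \<beta>)" "M * (2 * C + c * \<beta>) \<le> K * (c * \<beta>)"
    and M: "2 \<le> M" "0 < d" "d \<le> 1/2" "1 \<le> M * d"
  shows "\<exists>t\<in>{a..b}. \<exists>N. \<forall>n\<ge>N. \<exists>m::int. \<bar>phase ((Ft ^^ n) (\<gamma> t)) - \<theta> - m\<bar> \<le> d"
proof -
  \<comment> \<open>A lower bound for the phase speed that a unit vector of \<open>E\<close>
    produces through \<open>rt\<close>.\<close>
  define \<sigma> where "\<sigma> = c * \<beta>"
  have \<sigma>: "0 < \<sigma>" using pos by (simp add: \<sigma>_def)
  have "0 < C" using pos(1) r'[of 0] by simp
  have "0 < G" using g'_pos[of 0] g'[of 0] by simp
  then have "0 < K" using K(1) by simp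
  define Q where "Q n t = (Ft ^^ n) (\<gamma> t)" for n t
  define V where "V n t = DFn n (\<gamma> t) (\<gamma>' t)" for n t
  define w where "w n t = phase (Q n t)" for n t
  define w' where "w' n t = dphase (Q n t) (V n t)" for n t
  define h where "h n t = norm (fst (V n t))" for n t
  have Q_Suc: "fst (Q (Suc n) t) = At (fst (Q n t))" for n t
    by (simp add: Q_def Ft_def)
  have V_Suc: "fst (V (Suc n) t) = A' (fst (Q n t)) (fst (V n t))"
      "snd (V (Suc n) t) = g' (w n t) * w' n t" for n t
    by (simp_all add: V_def Q_def w_def w'_def DF_def)
  have w'_der: "(w n has_real_derivative w' n t) (at t)" if "t \<in> {a..b}" for n t
  proof -
    have 1: "((\<lambda>t. Q n t) has_derivative (\<lambda>h. DFn n (\<gamma> t) (h *\<^sub>R \<gamma>' t))) (at t)"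
      unfolding Q_def
      using has_derivative_compose[OF \<gamma>[OF that, unfolded has_vector_derivative_def]
            has_derivative_funpow[OF has_derivative_Ft]] .
    have lin: "linear (DFn n (\<gamma> t))"
      by (rule has_derivative_linear[OF has_derivative_funpow[OF has_derivative_Ft]])
    have "((\<lambda>t. phase (Q n t)) has_derivative
        (\<lambda>h. dphase (Q n t) (DFn n (\<gamma> t) (h *\<^sub>R \<gamma>' t)))) (at t)"
      by (rule has_derivative_compose[OF 1 has_derivative_phase])
    also have "(\<lambda>h. dphase (Q n t) (DFn n (\<gamma> t) (h *\<^sub>R \<gamma>' t))) = (*) (w' n t)"
      by (simp add: linear_scale[OF lin] linear_scale[OF has_derivative_linear[OF has_derivative_phase]]
          w'_def V_def fun_eq_iff mult.commute)
    finally show ?thesis by (simp add: has_field_derivative_def w_def[abs_def])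
  qed
  have V_mem: "fst (V n t) \<in> E (fst (Q n t)) \<and> fst (V n t) \<noteq> 0" if "t \<in> {a..b}" for n t
  proof (induction n)
    case 0
    then show ?case using tangent[OF that] by (simp add: V_def Q_def)
  next
    case (Suc n)
    then have "0 < K * norm (fst (V n t))" using \<open>0 < K\<close> by simp
    also have "\<dots> \<le> norm (fst (V (Suc n) t))" using grow Suc by (simp add: V_Suc)
    finally show ?case using inv Suc by (simp add: V_Suc Q_Suc)
  qed
  have h_pos: "0 < h n t" if "t \<in> {a..b}" for n t
    using V_mem[OF that] by (simp add: h_def)
  have h_grow: "K * h n t \<le> h (Suc n) t" if "t \<in> {a..b}" for n t
    using grow V_mem[OF that, of n] by (simp add: h_def V_Suc)
  have w'_le: "\<bar>w' n t\<bar> \<le> \<bar>snd (V n t)\<bar> + C * h n t" for n t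
  proof -
    have "\<bar>r' (fst (fst (Q n t))) * fst (fst (V n t))\<bar> \<le> C * h n t"
      unfolding abs_mult h_def
      using r'[of "fst (fst (Q n t))"] pos(1) norm_fst_le[of "fst (fst (V n t))" "snd (fst (V n t))"]
      by (intro mult_mono) auto
    then show ?thesis unfolding w'_def dphase_def by linarith
  qed
  have w'_ge: "\<sigma> * h n t - \<bar>snd (V n t)\<bar> \<le> \<bar>w' n t\<bar>" if "t \<in> {a..b}" for n t
  proof -
    have "c * (\<beta> * h n t) \<le> r' (fst (fst (Q n t))) * \<bar>fst (fst (V n t))\<bar>"
      using r'(1)[of "fst (fst (Q n t))"] pos cone[of "fst (V n t)" "fst (Q n t)"] V_mem[OF that, of n] h_pos[OF that, of n]
      by (intro mult_mono) (auto simp: h_def)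
    also have "\<dots> = \<bar>r' (fst (fst (Q n t))) * fst (fst (V n t))\<bar>"
      using r'(1)[of "fst (fst (Q n t))"] pos(1) by (simp add: abs_mult)
    finally show ?thesis unfolding w'_def dphase_def \<sigma>_def by linarith
  qed
  \<comment> \<open>Compactness of the parameter interval bounds the initial slope. The bound
    \<open>B\<close> depends on the curve, but it enters only the waiting time
    \<open>N\<close>.\<close>
  have "\<exists>u\<in>{a..b}. \<forall>t\<in>{a..b}. \<bar>snd (\<gamma>' t)\<bar> / norm (fst (\<gamma>' t)) \<le> \<bar>snd (\<gamma>' u)\<bar> / norm (fst (\<gamma>' u))"
    using assms(1) cont tangent
    by (intro continuous_attains_sup) (auto intro!: continuous_intros)
  then obtain B where B: "\<And>t. t \<in> {a..b} \<Longrightarrow> \<bar>snd (\<gamma>' t)\<bar> / norm (fst (\<gamma>' t)) \<le> B" and "0 \<le> B"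
    using that by (metis abs_ge_zero divide_nonneg_nonneg norm_ge_zero)
  \<comment> \<open>The transient \<open>B / 2 ^ n\<close> is halved in each step because
    \<open>2 * G <= K\<close>, while \<open>\<sigma> / 4\<close> reproduces itself:
    \<open>G * \<sigma> / 4\<close> and \<open>G * C\<close> are each at most
    \<open>K * \<sigma> / 8\<close>.\<close>
  have slope: "\<bar>snd (V n t)\<bar> \<le> (B / 2 ^ n + \<sigma> / 4) * h n t" if "t \<in> {a..b}" for n t
  proof (induction n)
    case 0
    have "\<bar>snd (V 0 t)\<bar> \<le> B * h 0 t"
      using B[OF that] h_pos[OF that, of 0] by (simp add: V_def h_def divide_le_eq)
    also have "\<dots> \<le> (B / 2 ^ 0 + \<sigma> / 4) * h 0 t"
      using h_pos[OF that, of 0] \<sigma> by (intro mult_right_mono) auto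
    finally show ?case .
  next
    case (Suc n)
    have "G * (B / 2 ^ n) \<le> K / 2 * (B / 2 ^ n)" "G * \<sigma> \<le> K / 2 * \<sigma>"
      using K(1) \<open>0 \<le> B\<close> \<sigma> by (intro mult_right_mono; simp)+
    then have coeff: "G * (B / 2 ^ n + \<sigma> / 4 + C) \<le> (B / 2 ^ Suc n + \<sigma> / 4) * K"
      using K(2)[folded \<sigma>_def] by (simp add: algebra_simps)
    have "\<bar>snd (V (Suc n) t)\<bar> = g' (w n t) * \<bar>w' n t\<bar>"
      using g'_pos[of "w n t"] by (simp add: V_Suc abs_mult)
    also have "\<dots> \<le> G * ((B / 2 ^ n + \<sigma> / 4) * h n t + C * h n t)"
      using w'_le[of n t] Suc g'[of "w n t"] \<open>0 < G\<close> by (intro mult_mono) auto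
    also have "\<dots> = G * (B / 2 ^ n + \<sigma> / 4 + C) * h n t"
      by (simp add: algebra_simps)
    also have "\<dots> \<le> (B / 2 ^ Suc n + \<sigma> / 4) * K * h n t"
      using coeff h_pos[OF that, of n] by (intro mult_right_mono) auto
    also have "\<dots> = (B / 2 ^ Suc n + \<sigma> / 4) * (K * h n t)"
      by simp
    also have "\<dots> \<le> (B / 2 ^ Suc n + \<sigma> / 4) * h (Suc n) t"
      using h_grow[OF that, of n] \<open>0 \<le> B\<close> \<sigma> by (intro mult_left_mono) auto
    finally show ?case .
  qed
  \<comment> \<open>From step \<open>N\<close> on the transient is at most
    \<open>\<sigma> / 4\<close>, so the vertical part cancels at most half of
    \<open>\<sigma> * h\<close>.\<close>
  obtain N where N: "4 * B / \<sigma> < 2 ^ N"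
    using real_arch_pow[of 2 "4 * B / \<sigma>"] by auto
  have small: "\<bar>snd (V (N + n) t)\<bar> \<le> \<sigma> / 2 * h (N + n) t" if "t \<in> {a..b}" for n t
  proof -
    have "4 * B / \<sigma> < 2 ^ (N + n)"
      using N by (rule less_le_trans) (simp add: power_increasing)
    then have "B / 2 ^ (N + n) \<le> \<sigma> / 4"
      using \<sigma> by (simp add: field_simps)
    then have "B / 2 ^ (N + n) + \<sigma> / 4 \<le> \<sigma> / 2" by linarith
    then have "(B / 2 ^ (N + n) + \<sigma> / 4) * h (N + n) t \<le> \<sigma> / 2 * h (N + n) t"
      using h_pos[OF that, of "N + n"] by (rule mult_right_mono[OF _ less_imp_le])
    with slope[OF that, of "N + n"] show ?thesis by linarith
  qed
  have lower: "\<sigma> / 2 * h (N + n) t \<le> \<bar>w' (N + n) t\<bar>" if "t \<in> {a..b}" for n t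
    using w'_ge[OF that, of "N + n"] small[OF that, of n] by linarith
  have "\<exists>t\<in>{a..b}. \<exists>N'. \<forall>n\<ge>N'. \<exists>m::int. \<bar>w (N + n) t - \<theta> - m\<bar> \<le> d"
  proof (rule expanding_phases_track_arc[OF assms(1) _ _ _ M])
    fix n t assume t: "t \<in> {a..b}"
    show "(w (N + n) has_real_derivative w' (N + n) t) (at t)"
      using w'_der[OF t] .
    have "0 < \<sigma> / 2 * h (N + n) t" using \<sigma> h_pos[OF t] by simp
    then show "w' (N + n) t \<noteq> 0" using lower[OF t, of n] by linarith
    \<comment> \<open>With \<open>h\<close> taken at step \<open>N + n\<close>, the phase speed
      there is at most \<open>(C + \<sigma> / 2) * h\<close> and the next one at least
      \<open>\<sigma> / 2 * (K * h)\<close>. The third condition on \<open>K\<close> says that the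
      quotient of these bounds is at least \<open>M\<close>.\<close>
    have "\<bar>w' (N + n) t\<bar> \<le> (C + \<sigma> / 2) * h (N + n) t"
      using w'_le[of "N + n" t] small[OF t, of n] by (simp add: algebra_simps)
    then have "M * \<bar>w' (N + n) t\<bar> \<le> M * ((C + \<sigma> / 2) * h (N + n) t)"
      using M(1) by (intro mult_left_mono) auto
    also have "\<dots> = M * (2 * C + \<sigma>) / 2 * h (N + n) t"
      by (simp add: field_simps)
    also have "\<dots> \<le> K * \<sigma> / 2 * h (N + n) t"
      using K(3) h_pos[OF t, of "N + n"] by (intro mult_right_mono) (auto simp: \<sigma>_def)
    also have "\<dots> = \<sigma> / 2 * (K * h (N + n) t)"
      by simp
    also have "\<dots> \<le> \<sigma> / 2 * h (N + Suc n) t"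
      using h_grow[OF t, of "N + n"] \<sigma> by (intro mult_left_mono) auto
    also have "\<dots> \<le> \<bar>w' (N + Suc n) t\<bar>"
      by (rule lower[OF t])
    finally show "M * \<bar>w' (N + n) t\<bar> \<le> \<bar>w' (N + Suc n) t\<bar>" .
  qed
  then obtain t N' where t: "t \<in> {a..b}"
    and tr: "\<And>n. n \<ge> N' \<Longrightarrow> \<exists>m::int. \<bar>w (N + n) t - \<theta> - m\<bar> \<le> d" by blast
  have "\<exists>m::int. \<bar>phase ((Ft ^^ n) (\<gamma> t)) - \<theta> - m\<bar> \<le> d" if "n \<ge> N + N'" for n
    using tr[of "n - N"] that by (simp add: w_def Q_def)
  with t show ?thesis by blast
qed

end


section \<open>Unstable curves\<close>

text \<open>In dimension one the operator-valued derivative is multiplication by a number, which is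
  the value of \<open>circle_deriv\<close>. It is continuous since the operator-valued derivative is
  itself differentiable.\<close>

lemma circle_C2_lift:
  assumes "torus_C2 circ f"
  obtains ft f' where "is_lift circ ft f" "\<And>x. (ft has_real_derivative f' x) (at x)"
    "\<And>x. circle_deriv f (circ x) = f' x" "continuous_on UNIV f'"
proof -
  obtain ft and Df :: "real \<Rightarrow> real \<Rightarrow>\<^sub>L real" and D2f :: "real \<Rightarrow> real \<Rightarrow>\<^sub>L (real \<Rightarrow>\<^sub>L real)" where
    lift: "is_lift circ ft f"
    and Df: "\<And>x. (ft has_derivative blinfun_apply (Df x)) (at x)"
    and D2f: "\<And>x. (Df has_derivative blinfun_apply (D2f x)) (at x)"
    using assms unfolding torus_C2_def C2_map_def by blast
  define f' where "f' x = blinfun_apply (Df x) 1" for x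
  have eq: "blinfun_apply (Df x) = (*) (f' x)" for x
  proof
    fix h
    show "blinfun_apply (Df x) h = f' x * h"
      using blinfun.scaleR_right[of "Df x" h 1] by (simp add: f'_def mult.commute)
  qed
  show thesis
  proof
    show "(ft has_real_derivative f' x) (at x)" for x
      using Df[of x] by (simp add: has_field_derivative_def eq)
    show "circle_deriv f (circ x) = f' x" for x
      by (simp add: circle_deriv_def circ.tderiv_eq[OF lift Df] f'_def)
    have "continuous_on UNIV Df"
      using D2f by (auto intro!: continuous_at_imp_continuous_on has_derivative_continuous)
    then show "continuous_on UNIV f'"
      unfolding f'_def by (intro continuous_intros)
  qed (fact lift)
qed

section \<open>Lines, their unit vectors and direct sums\<close>

lemma span_singleton_scaleR:
  fixes e :: "'v::real_vector"
  assumes "s \<noteq> 0"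
  shows "span {s *\<^sub>R e} = span {e}"
proof
  show "span {s *\<^sub>R e} \<subseteq> span {e}"
    by (rule span_minimal) (simp_all add: span_base span_scale)
  have "(1 / s) *\<^sub>R (s *\<^sub>R e) \<in> span {s *\<^sub>R e}"
    by (intro span_scale span_base) simp
  then show "span {e} \<subseteq> span {s *\<^sub>R e}"
    using assms by (intro span_minimal) simp_all
qed

lemma line_spanned:
  fixes E :: "'v::real_vector set"
  assumes "line E"
  obtains e where "e \<noteq> 0" "E = span {e}"
proof -
  obtain B where B: "B \<subseteq> E" "independent B" "E \<subseteq> span B" "card B = 1"
    using assms basis_exists[of E] by (metis line_def)
  then obtain e where e: "B = {e}" by (auto simp: card_1_singleton_iff)
  show thesis
  proof
    show "e \<noteq> 0" using B(2) e by (simp add: dependent_single)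
    show "E = span {e}"
      using assms B e by (metis line_def span_minimal subset_antisym)
  qed
qed

text \<open>Justifies the definite description: a generator of a line other than the vertical axis
  has nonzero first coordinate, and norm and sign then single out one multiple.\<close>

lemma unit_u:
  assumes "line (E p)" "E p \<noteq> span {(0, 1)}"
  shows "unit_u E p \<in> E p" "norm (unit_u E p) = 1" "E p = span {unit_u E p}"
proof -
  obtain e where e: "e \<noteq> 0" "E p = span {e}"
    using line_spanned[OF assms(1)] by blast
  have "fst e \<noteq> 0"
  proof
    assume 0: "fst e = 0"
    then have "e = snd e *\<^sub>R (0, 1)" "snd e \<noteq> 0" using e(1) by (auto simp: prod_eq_iff)
    then have "span {e} = span {(0, 1)}" by (metis span_singleton_scaleR)
    with e(2) assms(2) show False by simp
  qed
  define u where "u = (sgn (fst e) / norm e) *\<^sub>R e"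
  have u: "u \<in> E p" "norm u = 1" "0 < fst u"
    using e \<open>fst e \<noteq> 0\<close> by (auto simp: u_def span_base span_scale abs_sgn_eq sgn_mult_abs sgn_if)
  have span: "E p = span {u}"
    using e \<open>fst e \<noteq> 0\<close> unfolding u_def by (subst span_singleton_scaleR) (auto simp: sgn_zero_iff)
  have "v = u" if "v \<in> E p" "norm v = 1" "0 < fst v" for v
  proof -
    obtain s where "v = s *\<^sub>R u" using \<open>v \<in> E p\<close> span by (auto simp: span_singleton)
    with that u show ?thesis by (auto simp: zero_less_mult_iff)
  qed
  with u have "unit_u E p = u"
    unfolding unit_u_def by (intro the_equality) blast+
  with u span show "unit_u E p \<in> E p" "norm (unit_u E p) = 1" "E p = span {unit_u E p}"
    by auto
qed

text \<open>Otherwise \<open>v + 0 + 0\<close> and \<open>0 + v + 0\<close> would be two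
  decompositions of \<open>v\<close>.\<close>

lemma direct_sum3_disjoint:
  assumes "direct_sum3 E1 E2 E3" "0 \<in> E1" "0 \<in> E2" "0 \<in> E3" "v \<in> E1" "v \<in> E2"
  shows "v = 0"
proof -
  have "\<exists>!x. case x of (a, b, c) \<Rightarrow> a \<in> E1 \<and> b \<in> E2 \<and> c \<in> E3 \<and> v = a + b + c"
    using assms(1) unfolding direct_sum3_def by blast
  then obtain x where
    x: "\<And>y. (case y of (a, b, c) \<Rightarrow> a \<in> E1 \<and> b \<in> E2 \<and> c \<in> E3 \<and> v = a + b + c) \<Longrightarrow> y = x"
    by (elim ex1E) blast
  have "(v, 0, 0) = x" "(0, v, 0) = x"
    using assms(2-) by (auto intro!: x)
  then show ?thesis by blast
qed

lemma continuous_line_field_zero: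
  assumes "continuous_line_field E"
  shows "0 \<in> E p"
proof -
  obtain v where "E p = span {v p}"
    using assms unfolding continuous_line_field_def by blast
  then show ?thesis by (simp add: span_zero)
qed

text \<open>The interval may end at \<open>t\<close>, so the short interval is laid out from
  \<open>t\<close> towards another point \<open>s\<close> of \<open>I\<close>.\<close>

lemma interval_short_subinterval:
  fixes I :: "real set"
  assumes "is_interval I" "interior I \<noteq> {}" "t \<in> I" "0 < e"
  obtains a b where "a < b" "{a..b} \<subseteq> I" "{a..b} \<subseteq> ball t e"
proof -
  have "\<not> I \<subseteq> {t}"
    using assms(2) interior_mono[of I "{t}"] by auto
  then obtain s where s: "s \<in> I" "s \<noteq> t" by auto
  define x where "x = min (e / 2) \<bar>s - t\<bar>"
  have x: "0 < x" "x \<le> \<bar>s - t\<bar>" "x < e" using s assms(4) by (auto simp: x_def)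
  show thesis
  proof (cases "t < s")
    case True
    show thesis
    proof
      show "{t..t + x} \<subseteq> I"
        using x True mem_is_interval_1_I[OF assms(1,3) s(1)] by auto
    qed (use x in \<open>auto simp: dist_real_def\<close>)
  next
    case False
    show thesis
    proof
      show "{t - x..t} \<subseteq> I"
        using x False mem_is_interval_1_I[OF assms(1) s(1) assms(3)] by auto
    qed (use x in \<open>auto simp: dist_real_def\<close>)
  qed
qed

text \<open>Supplies invariance, expansion and the cone condition for
  \<open>phases_track_arc\<close>. The line \<open>EuA\<close> is spanned by \<open>unit_u\<close>,
  which \<open>L\<close> stretches by \<open>alpha_u\<close> and whose first coordinate is at least
  \<open>\<beta>\<close>.\<close>

lemma unstable_expansion:
  assumes lift: "is_lift pi2 At A" and deriv: "(At has_derivative L) (at q)"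
    and anosov: "anosov A EsA EuA lamA" and A3: "assm_A3 A EsA EuA \<beta>"
    and K: "K \<le> alpha_u_min A EuA" and v: "v \<in> EuA (pi2 q)"
  shows "L v \<in> EuA (pi2 (At q))" "K * norm v \<le> norm (L v)" "\<beta> * norm v \<le> \<bar>fst v\<bar>"
proof -
  let ?u = "unit_u EuA"
  have L: "tderiv pi2 A (pi2 q) = L" by (rule pi2.tderiv_eq[OF lift deriv])
  have img: "L ` EuA (pi2 q) = EuA (A (pi2 q))"
    using anosov L unfolding anosov_def invariant_field_def by metis
  have u: "?u p \<in> EuA p" "norm (?u p) = 1" "EuA p = span {?u p}" for p
    using anosov A3 unit_u[of EuA p] unfolding anosov_def assm_A3_def by blast+
  show "L v \<in> EuA (pi2 (At q))"
    using img v lift unfolding is_lift_def by (metis image_eqI)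
  obtain s where s: "v = s *\<^sub>R ?u (pi2 q)"
    using v u(3)[of "pi2 q"] by (auto simp: span_singleton)
  have "\<beta> \<le> ?u (pi2 q) \<bullet> (1, 0)"
    using A3 unfolding assm_A3_def by blast
  then have "\<beta> \<le> fst (?u (pi2 q))"
    by (cases "?u (pi2 q)") simp
  then show "\<beta> * norm v \<le> \<bar>fst v\<bar>"
    using mult_right_mono[of \<beta> "\<bar>fst (?u (pi2 q))\<bar>" "\<bar>s\<bar>"] u(2)
    by (simp add: s abs_mult mult.commute)
  have "L (?u (pi2 q)) \<in> span {?u (A (pi2 q))}"
    using img u(1)[of "pi2 q"] u(3)[of "A (pi2 q)"] by blast
  then obtain a where a: "L (?u (pi2 q)) = a *\<^sub>R ?u (A (pi2 q))"
    by (auto simp: span_singleton)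
  have "?u (A (pi2 q)) \<noteq> 0" using u(2)[of "A (pi2 q)"] by auto
  then have alpha: "alpha_u A EuA (pi2 q) = a"
    unfolding alpha_u_def L a by (intro the_equality) auto
  \<comment> \<open>An \<open>INF\<close> of reals lies below the values only if these are bounded
    below; positivity of \<open>alpha_u\<close> provides this.\<close>
  have "bdd_below (range (alpha_u A EuA))"
    using A3 unfolding assm_A3_def by (intro bdd_belowI[of _ 0]) (auto intro: less_imp_le)
  then have "alpha_u_min A EuA \<le> alpha_u A EuA (pi2 q)"
    unfolding alpha_u_min_def by (rule cINF_lower) simp
  with K alpha have "K \<le> \<bar>a\<bar>" by simp
  moreover have "L v = (s * a) *\<^sub>R ?u (A (pi2 q))"
    using linear_scale[OF has_derivative_linear[OF deriv]] by (simp add: s a)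
  ultimately show "K * norm v \<le> norm (L v)"
    using u(2) mult_right_mono[of K "\<bar>a\<bar>" "\<bar>s\<bar>"] by (simp add: s abs_mult mult.commute)
qed

text \<open>Any neighbourhood of a point of \<open>W\<close> contains the image of a short parameter
  interval, and the constants in \<open>phases_track_arc\<close> do not depend on the length of that
  interval.\<close>

lemma (in skew_product_lift) arc_tracking_dense:
  assumes anosov: "anosov A EsA EuA lamA" and A3: "assm_A3 A EsA EuA \<beta>"
    and alpha: "K \<le> alpha_u_min A EuA"
    and split: "ph_splitting (skew A g r) EsA EuA lamA gmin gmax Es Eu"
    and seg: "curve_segment Eu \<W> W"
    and bounds: "\<And>x. c \<le> r' x" "\<And>x. r' x \<le> C" "\<And>x. g' x \<le> G" "0 < c"
    and K: "2 * G \<le> K" "8 * G * C \<le> K * (c * \<beta>)" "M * (2 * C + c * \<beta>) \<le> K * (c * \<beta>)"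
    and M: "2 \<le> M" "0 < d" "d \<le> 1/2" "1 \<le> M * d"
  shows "W \<subseteq> closure {p \<in> W. \<exists>q N. p = pi3 q \<and>
           (\<forall>n\<ge>N. \<exists>m::int. \<bar>phase ((Ft ^^ n) q) - \<theta> - m\<bar> \<le> d)}"
    (is "W \<subseteq> closure ?S")
proof
  fix p assume "p \<in> W"
  obtain \<gamma> I where "unit_speed_curve Eu \<gamma>" and I: "is_interval I" "interior I \<noteq> {}"
    and W: "W = (pi3 \<circ> \<gamma>) ` I"
    using seg unfolding curve_segment_def by blast
  then obtain \<gamma>' where \<gamma>'_cont: "continuous_on UNIV \<gamma>'"
    and \<gamma>': "\<And>t. (\<gamma> has_vector_derivative \<gamma>' t) (at t)" "\<And>t. norm (\<gamma>' t) = 1"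
      "\<And>t. \<gamma>' t \<in> Eu (pi3 (\<gamma> t))"
    unfolding unit_speed_curve_def by blast
  have "continuous_on UNIV \<gamma>"
    using \<gamma>'(1) by (auto intro!: continuous_at_imp_continuous_on has_vector_derivative_continuous)
  then have cont: "continuous_on UNIV (pi3 \<circ> \<gamma>)"
    by (intro continuous_on_compose continuous_on_pi3)
  have tangent: "fst (\<gamma>' t) \<in> EuA (pi2 (fst (\<gamma> t))) \<and> fst (\<gamma>' t) \<noteq> 0" for t
  proof
    have "Eu (pi3 (\<gamma> t)) \<subseteq> EuA (fst (pi3 (\<gamma> t))) \<times> UNIV"
      using split unfolding ph_splitting_def by blast
    then show "fst (\<gamma>' t) \<in> EuA (pi2 (fst (\<gamma> t)))"
      using \<gamma>'(3)[of t] by (auto simp: pi3_def)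
    \<comment> \<open>A vertical velocity would lie in both \<open>Eu\<close> and \<open>Ec\<close>,
      which share only 0.\<close>
    show "fst (\<gamma>' t) \<noteq> 0"
    proof
      assume "fst (\<gamma>' t) = 0"
      then have "\<gamma>' t = snd (\<gamma>' t) *\<^sub>R ((0, 0), 1)" by (simp add: prod_eq_iff)
      then have "\<gamma>' t \<in> Ec" unfolding Ec_def by (metis insertI1 span_base span_scale)
      moreover have "direct_sum3 (Eu (pi3 (\<gamma> t))) Ec (Es (pi3 (\<gamma> t)))"
        using split unfolding ph_splitting_def by blast
      moreover have "0 \<in> Eu (pi3 (\<gamma> t))" "0 \<in> Es (pi3 (\<gamma> t))" "0 \<in> Ec"
        using split unfolding ph_splitting_def by (auto intro: continuous_line_field_zero simp: Ec_def span_zero)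
      ultimately have "\<gamma>' t = 0"
        using \<gamma>'(3) direct_sum3_disjoint by metis
      then show False using \<gamma>'(2)[of t] by simp
    qed
  qed
  show "p \<in> closure ?S"
  proof (rule ccontr)
    assume "p \<notin> closure ?S"
    define U where "U = - closure ?S"
    have U: "open U" "p \<in> U" using \<open>p \<notin> closure ?S\<close> by (auto simp: U_def)
    obtain t where t: "t \<in> I" "p = pi3 (\<gamma> t)" using \<open>p \<in> W\<close> W by auto
    have "open ((pi3 \<circ> \<gamma>) -` U)" using U(1) cont by (simp add: open_vimage)
    moreover have "t \<in> (pi3 \<circ> \<gamma>) -` U" using t U by simp
    ultimately obtain e where e: "0 < e" "ball t e \<subseteq> (pi3 \<circ> \<gamma>) -` U"
      by (metis open_contains_ball)
    obtain a b where ab: "a < b" "{a..b} \<subseteq> I" "{a..b} \<subseteq> ball t e"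
      using interval_short_subinterval[OF I t(1) e(1)] by blast
    have "0 < \<beta>" using A3 by (simp add: assm_A3_def)
    have "continuous_on {a..b} \<gamma>'" using \<gamma>'_cont continuous_on_subset by blast
    note expansion = unstable_expansion[OF lift_A deriv_A anosov A3 alpha]
    have "\<exists>t\<in>{a..b}. \<exists>N. \<forall>n\<ge>N. \<exists>m::int. \<bar>phase ((Ft ^^ n) (\<gamma> t)) - \<theta> - m\<bar> \<le> d"
    proof (rule phases_track_arc[where \<gamma>' = \<gamma>' and E = "\<lambda>p. EuA (pi2 p)" and K = K and \<beta> = \<beta>
          and c = c and C = C and G = G and M = M])
      fix p v assume "v \<in> EuA (pi2 p)"
      then show "A' p v \<in> EuA (pi2 (At p))" "K * norm v \<le> norm (A' p v)" "\<beta> * norm v \<le> \<bar>fst v\<bar>"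
        by (rule expansion)+
    qed (use ab(1) \<gamma>'(1) \<open>continuous_on {a..b} \<gamma>'\<close> tangent bounds \<open>0 < \<beta>\<close> K M in blast)+
    then obtain s N where s: "s \<in> {a..b}"
      "\<forall>n\<ge>N. \<exists>m::int. \<bar>phase ((Ft ^^ n) (\<gamma> s)) - \<theta> - m\<bar> \<le> d"
      by blast
    have "pi3 (\<gamma> s) \<in> W" using W ab(2) s(1) by auto
    with s(2) have "pi3 (\<gamma> s) \<in> ?S" by blast
    moreover have "s \<in> (pi3 \<circ> \<gamma>) -` U" using s(1) ab(3) e(2) by blast
    then have "pi3 (\<gamma> s) \<in> U" by simp
    ultimately show False using closure_subset[of ?S] unfolding U_def by blast
  qed
qed


section \<open>Center Lyapunov exponents\<close>

text \<open>The finitely many terms before \<open>N\<close> shift the lower bound for the mean by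
  \<open>C / n\<close>, which tends to 0.\<close>

lemma mean_ge_imp_liminf_ge:
  fixes f :: "nat \<Rightarrow> real"
  assumes "\<And>n. n \<ge> N \<Longrightarrow> l \<le> f n"
  shows "ereal l \<le> liminf (\<lambda>n. ereal ((\<Sum>k<n. f k) / n))"
proof -
  define C where "C = (\<Sum>k<N. f k) - N * l"
  have sum: "C + n * l \<le> (\<Sum>k<n. f k)" if "N \<le> n" for n
    using that
  proof (induction n rule: dec_induct)
    case (step n)
    then show ?case using assms[of n] by (simp add: algebra_simps)
  qed (simp add: C_def)
  have "(\<lambda>n. C / real n + l) \<longlonglongrightarrow> 0 + l"
    by (intro tendsto_add tendsto_const lim_const_over_n)
  then have "liminf (\<lambda>n. ereal (C / n + l)) = ereal l"
    by (intro lim_imp_Liminf) auto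
  moreover have "\<forall>\<^sub>F n in sequentially. ereal (C / n + l) \<le> ereal ((\<Sum>k<n. f k) / n)"
    using eventually_ge_at_top[of "max N 1"]
  proof eventually_elim
    case (elim n)
    then have "C / n + l = (C + n * l) / n" by (simp add: field_simps)
    also have "\<dots> \<le> (\<Sum>k<n. f k) / n" using elim sum[of n] by (intro divide_right_mono) auto
    finally show ?case by simp
  qed
  ultimately show ?thesis
    using Liminf_mono by metis
qed

text \<open>Dual to the lower bound, by passing to \<open>- f\<close>.\<close>

lemma mean_le_imp_limsup_le:
  fixes f :: "nat \<Rightarrow> real"
  assumes "\<And>n. n \<ge> N \<Longrightarrow> f n \<le> l"
  shows "limsup (\<lambda>n. ereal ((\<Sum>k<n. f k) / n)) \<le> ereal l"
proof -
  have "ereal (- l) \<le> liminf (\<lambda>n. ereal ((\<Sum>k<n. - f k) / n))"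
    by (rule mean_ge_imp_liminf_ge[of N]) (use assms in auto)
  also have "\<dots> = liminf (\<lambda>n. - ereal ((\<Sum>k<n. f k) / n))"
    by (simp add: sum_negf)
  also have "\<dots> = - limsup (\<lambda>n. ereal ((\<Sum>k<n. f k) / n))"
    by (rule ereal_Liminf_uminus)
  finally show ?thesis
    by (metis ereal_minus_le_minus uminus_ereal.simps(1))
qed

text \<open>Continuity of \<open>g'\<close> at a lift of \<open>z\<close> gives \<open>d\<close>.
  Since \<open>g'\<close> factors through \<open>circ\<close> it has period 1, so the same
  \<open>d\<close> serves all integer translates.\<close>

lemma circle_deriv_near:
  assumes "\<And>x. circle_deriv g (circ x) = g' x" "continuous_on UNIV g'" "open S" "circle_deriv g z \<in> S"
  obtains x d where "0 < d" "\<And>y (m::int). \<bar>y - x - m\<bar> \<le> d \<Longrightarrow> g' y \<in> S"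
proof -
  obtain x where x: "circ x = z" using circ_surj by blast
  have "open (g' -` S)" "x \<in> g' -` S"
    using assms x by (auto intro: open_vimage)
  then obtain d where d: "0 < d" "cball x d \<subseteq> g' -` S"
    by (metis open_contains_cball)
  have "g' y \<in> S" if "\<bar>y - x - m\<bar> \<le> d" for y and m :: int
  proof -
    have "g' y = g' (y - m)"
      using assms(1)[of y] assms(1)[of "y - m"] circ_eq_iff[of y "y - m"] by simp
    moreover have "y - m \<in> cball x d" using that by (simp add: dist_real_def)
    ultimately show ?thesis using d(2) by auto
  qed
  with d(1) that show thesis by blast
qed

section \<open>The sign of the center exponent from the phases\<close>

lemma (in skew_product_lift) center_growth_liminf:
  assumes "\<And>n. n \<ge> N \<Longrightarrow> \<kappa> \<le> g' (phase ((Ft ^^ n) q))" "1 < \<kappa>"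
  shows "0 < liminf (center_growth (skew A g r) (pi3 q))"
proof -
  have "ereal (ln \<kappa>) \<le> liminf (center_growth (skew A g r) (pi3 q))"
    unfolding center_growth_eq using assms g'_pos
    by (intro mean_ge_imp_liminf_ge[of N]) auto
  moreover have "0 < ereal (ln \<kappa>)" using assms(2) by simp
  ultimately show ?thesis by (rule less_le_trans[rotated])
qed

lemma (in skew_product_lift) center_growth_limsup:
  assumes "\<And>n. n \<ge> N \<Longrightarrow> g' (phase ((Ft ^^ n) q)) \<le> \<kappa>" "\<kappa> < 1"
  shows "limsup (center_growth (skew A g r) (pi3 q)) < 0"
proof -
  \<comment> \<open>Positivity of \<open>\<kappa>\<close> comes from \<open>g'_pos\<close>; it keeps
    the comparison of logarithms on the positive half-line.\<close>
  have "0 < \<kappa>" using assms(1)[of N] g'_pos less_le_trans by blast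
  have "limsup (center_growth (skew A g r) (pi3 q)) \<le> ereal (ln \<kappa>)"
    unfolding center_growth_eq using assms g'_pos \<open>0 < \<kappa>\<close>
    by (intro mean_le_imp_limsup_le[of N]) auto
  moreover have "ereal (ln \<kappa>) < 0" using assms(2) \<open>0 < \<kappa>\<close> by simp
  ultimately show ?thesis by (rule le_less_trans)
qed

text \<open>"Large enough" is rendered by a threshold \<open>K\<close> that depends on
  \<open>g\<close>, \<open>r\<close> and \<open>\<beta>\<close> and is chosen before
  \<open>A\<close>, the splitting and the curve.\<close>

theorem proposition4p3:
  fixes g r :: "circle \<Rightarrow> circle" and zr za :: circle and \<beta> :: real
  assumes "north_south g zr za"
    and "C1_diffeo circ r" and "orientation_preserving r" and "assm_A2 r"
    and "\<beta> > 0"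
  shows "\<exists>K. \<forall>A EsA EuA lamA.
    anosov A EsA EuA lamA \<and> assm_A1 g zr za lamA \<and> assm_A3 A EsA EuA \<beta> \<and>
    alpha_u_min A EuA \<ge> K \<longrightarrow>
    (\<forall>Es Eu \<W> W.
      ph_splitting (skew A g r) EsA EuA lamA (circle_deriv g za) (circle_deriv g zr) Es Eu \<and>
      foliation_tangent_to Eu \<W> \<and> invariant_foliation (skew A g r) \<W> \<and>
      curve_segment Eu \<W> W \<longrightarrow>
      dense_in {p \<in> W. liminf (center_growth (skew A g r) p) > 0} W \<and>
      dense_in {p \<in> W. limsup (center_growth (skew A g r) p) < 0} W)"
proof (cases "1 < circle_deriv g zr \<and> circle_deriv g za < 1")
  case False
  \<comment> \<open>Here \<open>assm_A1\<close> is false for every \<open>lamA\<close>, so any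
    \<open>K\<close> serves.\<close>
  then show ?thesis by (auto simp: assm_A1_def)
next
  case True
  define G where "G = circle_deriv g zr"
  \<comment> \<open>Midpoints between 1 and the extreme derivatives: \<open>g'\<close> stays beyond
    them on whole arcs, which bounds the exponents away from 0.\<close>
  define \<kappa>r \<kappa>a where "\<kappa>r = (1 + G) / 2" and "\<kappa>a = (1 + circle_deriv g za) / 2"
  have \<kappa>: "1 < \<kappa>r" "\<kappa>r < circle_deriv g zr" "\<kappa>a < 1" "circle_deriv g za < \<kappa>a"
    using True by (auto simp: \<kappa>r_def \<kappa>a_def G_def)
  obtain gt g' where g: "is_lift circ gt g" "\<And>x. (gt has_real_derivative g' x) (at x)"
      "\<And>x. circle_deriv g (circ x) = g' x" "continuous_on UNIV g'"
    using circle_C2_lift[of g] assms(1) unfolding north_south_def by metis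
  obtain rt r' where r: "is_lift circ rt r" "\<And>x. (rt has_real_derivative r' x) (at x)"
      "\<And>x. circle_deriv r (circ x) = r' x"
    using circle_C2_lift[of r] assms(4) unfolding assm_A2_def by metis
  have g'_pos: "0 < g' x" and g'_le: "g' x \<le> G" for x
    using assms(1) unfolding north_south_def G_def g(3)[symmetric] by blast+
  obtain c C where c: "0 < c" and r': "\<And>x. c \<le> r' x" "\<And>x. r' x \<le> C"
    using assms(4) unfolding assm_A2_def r(3)[symmetric] by metis
  obtain xr dr where dr: "0 < dr" "\<And>y (m::int). \<bar>y - xr - m\<bar> \<le> dr \<Longrightarrow> g' y \<in> {\<kappa>r<..}"
    by (rule circle_deriv_near[OF g(3,4), of "{\<kappa>r<..}" zr]) (use \<kappa> in auto)
  obtain xa da where da: "0 < da" "\<And>y (m::int). \<bar>y - xa - m\<bar> \<le> da \<Longrightarrow> g' y \<in> {..<\<kappa>a}"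
    by (rule circle_deriv_near[OF g(3,4), of "{..<\<kappa>a}" za]) (use \<kappa> in auto)
  define d where "d = min (1/2) (min dr da)"
  have d: "0 < d" "d \<le> 1/2" "d \<le> dr" "d \<le> da" using dr(1) da(1) by (auto simp: d_def)
  \<comment> \<open>The least expansion for which an arc of length \<open>2 * d\<close> forces the
    next phase increment to be at least 2.\<close>
  define M where "M = 1 / d"
  have M: "2 \<le> M" "1 \<le> M * d" using d by (auto simp: M_def field_simps)
  define \<sigma> where "\<sigma> = c * \<beta>"
  have \<sigma>: "0 < \<sigma>" using c assms(5) by (simp add: \<sigma>_def)
  \<comment> \<open>The three terms provide, in turn, the halving of the slope transient, a small
    stationary slope, and expansion of the phase speed by \<open>M\<close>.\<close>
  define K where "K = max (2 * G) (max (8 * G * C / \<sigma>) (M * (2 * C + \<sigma>) / \<sigma>))"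
  have K: "2 * G \<le> K" "8 * G * C \<le> K * \<sigma>" "M * (2 * C + \<sigma>) \<le> K * \<sigma>"
    using \<sigma> by (auto simp: K_def pos_divide_le_eq[symmetric])
  show ?thesis
  proof (intro exI[of _ K] allI impI; elim conjE)
    fix A EsA EuA lamA Es Eu \<W> W
    assume A: "anosov A EsA EuA lamA" and A3: "assm_A3 A EsA EuA \<beta>"
      and alpha: "K \<le> alpha_u_min A EuA"
      and split: "ph_splitting (skew A g r) EsA EuA lamA (circle_deriv g za) (circle_deriv g zr) Es Eu"
      and seg: "curve_segment Eu \<W> W"
    obtain At and A' :: "vec2 \<Rightarrow> vec2 \<Rightarrow>\<^sub>L vec2" where At: "is_lift pi2 At A"
        "\<And>p. (At has_derivative blinfun_apply (A' p)) (at p)"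
      using A unfolding anosov_def C2_diffeo_def torus_C2_def C2_map_def by blast
    interpret skew_product_lift A g r At "\<lambda>p. blinfun_apply (A' p)" gt g' rt r'
      by unfold_locales (fact At g r g'_pos)+
    note tracking = arc_tracking_dense[OF A A3 alpha split seg r' g'_le c
        K[unfolded \<sigma>_def] M(1) d(1,2) M(2)]
    have "0 < liminf (center_growth (skew A g r) p)"
      if tr: "\<exists>q N. p = pi3 q \<and> (\<forall>n\<ge>N. \<exists>m::int. \<bar>phase ((Ft ^^ n) q) - xr - m\<bar> \<le> d)" for p
    proof -
      obtain q N where p: "p = pi3 q"
        and q: "\<And>n. n \<ge> N \<Longrightarrow> \<exists>m::int. \<bar>phase ((Ft ^^ n) q) - xr - m\<bar> \<le> d"
        using tr by blast
      have "\<kappa>r \<le> g' (phase ((Ft ^^ n) q))" if "n \<ge> N" for n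
      proof -
        obtain m :: int where m: "\<bar>phase ((Ft ^^ n) q) - xr - m\<bar> \<le> d"
          using q[OF \<open>n \<ge> N\<close>] by blast
        show ?thesis using dr(2)[OF order_trans[OF m d(3)]] by simp
      qed
      then show ?thesis
        unfolding p using \<kappa>(1) by (rule center_growth_liminf)
    qed
    then have repelling: "W \<subseteq> closure {p \<in> W. 0 < liminf (center_growth (skew A g r) p)}"
      by (intro order_trans[OF tracking[where \<theta> = xr] closure_mono]) blast
    have "limsup (center_growth (skew A g r) p) < 0"
      if tr: "\<exists>q N. p = pi3 q \<and> (\<forall>n\<ge>N. \<exists>m::int. \<bar>phase ((Ft ^^ n) q) - xa - m\<bar> \<le> d)" for p
    proof -
      obtain q N where p: "p = pi3 q"
        and q: "\<And>n. n \<ge> N \<Longrightarrow> \<exists>m::int. \<bar>phase ((Ft ^^ n) q) - xa - m\<bar> \<le> d"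
        using tr by blast
      have "g' (phase ((Ft ^^ n) q)) \<le> \<kappa>a" if "n \<ge> N" for n
      proof -
        obtain m :: int where m: "\<bar>phase ((Ft ^^ n) q) - xa - m\<bar> \<le> d"
          using q[OF \<open>n \<ge> N\<close>] by blast
        show ?thesis using da(2)[OF order_trans[OF m d(4)]] by simp
      qed
      then show ?thesis
        unfolding p using \<kappa>(3) by (rule center_growth_limsup)
    qed
    then have attracting: "W \<subseteq> closure {p \<in> W. limsup (center_growth (skew A g r) p) < 0}"
      by (intro order_trans[OF tracking[where \<theta> = xa] closure_mono]) blast
    show "dense_in {p \<in> W. 0 < liminf (center_growth (skew A g r) p)} W \<and>
        dense_in {p \<in> W. limsup (center_growth (skew A g r) p) < 0} W"
      using repelling attracting by (simp add: dense_in_def)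
  qed
qed

end
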